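(* For every finite undirected graph $G(V,E)$ and every prime power $q\ge 2$, $$\mathbb{CAP}_q(G)\le VC(G),$$ where $VC(G)$ is the size of a minimum vertex cover of $G$.
   Context: Write $V=\{1,\dots,n\}$ and, for $i\in V$, let $N(i)$ be the set of neighbours of $i$. For $X\in\mathbb{F}_q^n$ and $I\subseteq V$, $X_I\in\mathbb{F}_q^{|I|}$ denotes the projection onto the coordinates in $I$. An RDSS (recoverable distributed storage system) code for $G$ is a set $\mathcal{C}\subseteq\mathbb{F}_q^n$ for which there are deterministic functions $f_i:\mathbb{F}_q^{|N(i)|}\to\mathbb{F}_q$, $i=1,\dots,n$, with $X_i=f_i(X_{N(i)})$ for all $X\in\mathcal{C}$ and all $i$. Its dimension is $\log_q|\mathcal{C}|$. $\mathbb{CAP}_q(G)$ denotes the maximum dimension of an RDSS code over $\mathbb{F}_q$ for $G$. A vertex cover is a set $U\subseteq V$ such that every edge has at least one endpoint in $U$. *)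

theory Defs
  imports
    "HOL-Number_Theory.Prime_Powers"
    "HOL-Algebra.Ring"
    "HOL-Algebra.Coset"
    "HOL-Library.FuncSet"
    Complex_Main
    "Graph_Theory.Pair_Digraph"
begin

text \<open>
  An undirected graph is represented by a symmetric digraph without parallel arcs, i.e. an edge
  between \<open>u\<close> and \<open>v\<close> is the pair of arcs \<open>(u, v)\<close>, \<open>(v, u)\<close>. The locale for finite graphs of
  this kind, \<open>pair_pseudo_graph\<close>, permits loops; those without loops form \<open>pair_graph\<close>.

  Words indexed by a set \<open>I\<close> of vertices are the extensional functions \<open>I \<rightarrow>\<^sub>E carrier F\<close>,
  and the projection of \<open>X\<close> onto the coordinates in \<open>I\<close> is \<open>restrict X I\<close>.
\<close>

definition neighbours :: "'v pair_pre_digraph \<Rightarrow> 'v \<Rightarrow> 'v set" where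
  "neighbours G i = {j \<in> pverts G. (i, j) \<in> parcs G}"

definition vertex_cover :: "'v pair_pre_digraph \<Rightarrow> 'v set \<Rightarrow> bool" where
  "vertex_cover G U \<longleftrightarrow> U \<subseteq> pverts G \<and> (\<forall>(u, v) \<in> parcs G. u \<in> U \<or> v \<in> U)"

definition VC :: "'v pair_pre_digraph \<Rightarrow> nat" where
  "VC G = Min {card U | U. vertex_cover G U}"

definition rdss_code ::
    "('a, 'm) ring_scheme \<Rightarrow> 'v pair_pre_digraph \<Rightarrow> ('v \<Rightarrow> 'a) set \<Rightarrow> bool" where
  "rdss_code F G C \<longleftrightarrow>
     C \<subseteq> (pverts G \<rightarrow>\<^sub>E carrier F) \<and>
     (\<exists>f. (\<forall>i \<in> pverts G. f i \<in> (neighbours G i \<rightarrow>\<^sub>E carrier F) \<rightarrow> carrier F) \<and>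
          (\<forall>X \<in> C. \<forall>i \<in> pverts G. X i = f i (restrict X (neighbours G i))))"

definition code_dim :: "('a, 'm) ring_scheme \<Rightarrow> ('v \<Rightarrow> 'a) set \<Rightarrow> real" where
  "code_dim F C = log (real (order F)) (real (card C))"

text \<open>
  The empty code has dimension \<open>-\<infinity>\<close> and so never attains the maximum; it is excluded because
  \<open>log b 0\<close> is not meaningful here. The lemmas below ensure that the minimum and the maximum
  range over finite nonempty sets.
\<close>

definition CAP :: "('a, 'm) ring_scheme \<Rightarrow> 'v pair_pre_digraph \<Rightarrow> real" where
  "CAP F G = Max {code_dim F C | C. rdss_code F G C \<and> C \<noteq> {}}"

lemma finite_vertex_covers:
  assumes "finite (pverts G)"
  shows "finite {card U | U. vertex_cover G U}"
proof -
  have "finite (card ` Pow (pverts G))" using assms by simp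
  moreover have "{card U | U. vertex_cover G U} \<subseteq> card ` Pow (pverts G)"
    by (auto simp: vertex_cover_def)
  ultimately show ?thesis by (rule finite_subset[rotated])
qed

lemma vertex_covers_nonempty:
  assumes "pair_wf_digraph G"
  shows "{card U | U. vertex_cover G U} \<noteq> {}"
proof -
  have "vertex_cover G (pverts G)"
    using pair_wf_digraph.in_arcsD1[OF assms] by (auto simp: vertex_cover_def)
  then show ?thesis by blast
qed

lemma finite_code_dims:
  assumes "finite (pverts G)" and "finite (carrier F)"
  shows "finite {code_dim F C | C. rdss_code F G C \<and> C \<noteq> {}}"
proof -
  have "finite (code_dim F ` Pow (pverts G \<rightarrow>\<^sub>E carrier F))"
    using assms by (simp add: finite_PiE)
  moreover have "{code_dim F C | C. rdss_code F G C \<and> C \<noteq> {}}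
      \<subseteq> code_dim F ` Pow (pverts G \<rightarrow>\<^sub>E carrier F)"
    by (auto simp: rdss_code_def)
  ultimately show ?thesis by (rule finite_subset[rotated])
qed

lemma code_dims_nonempty:
  assumes "carrier F \<noteq> {}"
  shows "{code_dim F C | C. rdss_code F G C \<and> C \<noteq> {}} \<noteq> {}"
proof -
  from assms obtain a where a: "a \<in> carrier F" by blast
  let ?X = "\<lambda>i \<in> pverts G. a"
  have "rdss_code F G {?X}"
    unfolding rdss_code_def using a by (intro conjI exI[of _ "\<lambda>_ _. a"]) auto
  then show ?thesis by blast
qed

end

theory Submission
  imports Defs
begin

text \<open>
  The complement of a vertex cover \<open>U\<close> is independent, so every coordinate outside \<open>U\<close> is
  recovered from coordinates in \<open>U\<close> alone. Hence the projection onto \<open>U\<close> is injective on a code,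
  which therefore has at most \<open>q ^ card U\<close> words.
\<close>

text \<open>An arc from \<open>i\<close> to a vertex outside \<open>U\<close> would be uncovered.
  Loops fit the same argument: a loop at \<open>i\<close> would force \<open>i\<close> into
  \<open>U\<close>.\<close>

lemma neighbours_subset_vertex_cover:
  assumes "vertex_cover G U" and "i \<notin> U"
  shows "neighbours G i \<subseteq> U"
  using assms by (auto simp: vertex_cover_def neighbours_def)

lemma rdss_code_inj_on_restrict:
  assumes "rdss_code F G C" and cover: "vertex_cover G U"
  shows "inj_on (\<lambda>X. restrict X U) C"
proof (rule inj_onI)
  fix X Y assume XY: "X \<in> C" "Y \<in> C" and eq: "restrict X U = restrict Y U"
  from assms(1) obtain f where sub: "C \<subseteq> (pverts G \<rightarrow>\<^sub>E carrier F)"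
    and f: "\<And>X i. X \<in> C \<Longrightarrow> i \<in> pverts G \<Longrightarrow> X i = f i (restrict X (neighbours G i))"
    unfolding rdss_code_def by (elim conjE exE) metis
  have onU: "X i = Y i" if "i \<in> U" for i
    using fun_cong[OF eq, of i] that by simp
  have "X i = Y i" if i: "i \<in> pverts G" for i
  proof (cases "i \<in> U")
    case False
    \<comment> \<open>All neighbours of \<open>i\<close> lie in \<open>U\<close>, where the words
      agree, so \<open>f i\<close> receives the same argument for both.\<close>
    have "restrict X (neighbours G i) = restrict Y (neighbours G i)"
      using neighbours_subset_vertex_cover[OF cover False] onU by (intro restrict_ext) blast
    then show ?thesis using f[OF XY(1) i] f[OF XY(2) i] by simp
  qed (rule onU)
  \<comment> \<open>Code words are extensional, so agreement on \<open>pverts G\<close> makes them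
    equal as functions.\<close>
  then show "X = Y"
    using XY sub by (intro PiE_ext[of X "pverts G" "\<lambda>_. carrier F" Y]) auto
qed

lemma rdss_code_card_le:
  assumes code: "rdss_code F G C" and cover: "vertex_cover G U"
    and "finite (pverts G)" and "finite (carrier F)"
  shows "card C \<le> order F ^ card U"
proof -
  have U: "U \<subseteq> pverts G" using cover by (simp add: vertex_cover_def)
  then have "finite U" using assms(3) by (rule finite_subset)
  have "(\<lambda>X. restrict X U) ` C \<subseteq> (U \<rightarrow>\<^sub>E carrier F)"
    using code U by (fastforce simp: rdss_code_def)
  moreover have "finite (U \<rightarrow>\<^sub>E carrier F)"
    using \<open>finite U\<close> assms(4) by (simp add: finite_PiE)
  ultimately have "card C \<le> card (U \<rightarrow>\<^sub>E carrier F)"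
    using rdss_code_inj_on_restrict[OF code cover] by (rule card_inj_on_le[rotated])
  then show ?thesis
    using \<open>finite U\<close> by (simp add: card_PiE order_def)
qed

lemma code_dim_le:
  assumes "rdss_code F G C" and "C \<noteq> {}" and "vertex_cover G U"
    and "finite (pverts G)" and "order F > 1"
  shows "code_dim F C \<le> card U"
proof -
  \<comment> \<open>An infinite carrier would have \<open>card\<close> equal to 0, contradicting
    \<open>order F > 1\<close>.\<close>
  have fin: "finite (carrier F)"
    using assms(5) by (intro card_ge_0_finite) (simp add: order_def)
  have "finite C"
    by (rule finite_subset[OF _ finite_PiE[OF assms(4)]])
      (use assms(1) fin in \<open>simp_all add: rdss_code_def\<close>)
  \<comment> \<open>Monotonicity of \<open>log\<close> holds only on positive arguments, hence the
    restriction to nonempty codes.\<close>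
  then have "card C > 0" using assms(2) by (simp add: card_gt_0_iff)
  moreover have "real (card C) \<le> real (order F) ^ card U"
    using rdss_code_card_le[OF assms(1,3,4) fin] by (metis of_nat_le_iff of_nat_power)
  ultimately have "code_dim F C \<le> log (order F) (real (order F) ^ card U)"
    unfolding code_dim_def using assms(5) by (intro log_mono) auto
  also have "\<dots> = card U" using assms(5) by (simp add: log_nat_power)
  finally show ?thesis .
qed

theorem lemma9:
  fixes G :: "'v pair_pre_digraph"
    and F :: "('a, 'm) ring_scheme"
    and q :: nat
  assumes "pair_pseudo_graph G"
    and "primepow q"
    and "Ring.field F" and "order F = q"
  shows "CAP F G \<le> real (VC G)"
proof -
  interpret pair_pseudo_graph G by fact
  have finV: "finite (pverts G)" by (rule pair_finite_verts)
  have ord: "order F > 1" using assms(2,4) by (simp add: primepow_gt_Suc_0)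
  then have "card (carrier F) > 0" by (simp add: order_def)
  then have finF: "finite (carrier F)" and neF: "carrier F \<noteq> {}"
    by (simp_all add: card_gt_0_iff)
  \<comment> \<open>The minimum over a finite nonempty set is attained, which yields a cover of size
    exactly \<open>VC G\<close>.\<close>
  have "VC G \<in> {card U | U. vertex_cover G U}"
    unfolding VC_def using finite_vertex_covers[OF finV] vertex_covers_nonempty
    by (intro Min_in) (auto intro: pair_wf_digraph_axioms)
  then obtain U where U: "vertex_cover G U" and "VC G = card U" by blast
  \<comment> \<open>This one cover bounds every nonempty code, so the bound passes to the
    maximum.\<close>
  then show ?thesis
    unfolding CAP_def
    using code_dim_le[OF _ _ U finV ord]
    by (subst Max_le_iff[OF finite_code_dims[OF finV finF] code_dims_nonempty[OF neF]]) auto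
qed

end
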